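(* There is an absolute constant $c>0$ such that for every $r\ge1$ and every positive integer $s$ there exists an instance of the linearly correlated prophets problem with cardinality constraint $r$ and row sparsity $s$ on which every online algorithm satisfies $\mathbb{E}[\mathrm{ALG}]\le\frac{1}{c\,s}\mathbb{E}[\mathrm{OPT}]$. That is, no algorithm can guarantee better than an $\Omega(s_{\mathrm{row}})$ approximation, even as $r\to\infty$.
   Context: Linearly correlated prophets problem with cardinality constraint $r$: there are $m$ mutually independent nonnegative random variables $Y_1,\dots,Y_m$ and a matrix $A\in\mathbb{R}_{\ge0}^{n\times m}$; the values are $X_i=\sum_jA_{ij}Y_j$. The row sparsity $s_{\mathrm{row}}$ is the maximum number of nonzero entries in a row of $A$. An online algorithm knows $A$ and the distributions of the $Y_j$, observes $X_1,\dots,X_n$ one at a time (never the $Y_j$), and irrevocably accepts or rejects each, accepting a set $Q$ with $|Q|\le r$; its reward is $\mathrm{ALG}=\sum_{i\in Q}X_i$. The benchmark is $\mathrm{OPT}=\sum_{i=1}^rX^{(i)}$, where $X^{(i)}$ is the $i$-th largest realized value among $X_1,\dots,X_n$. *)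

theory Defs
  imports "HOL-Probability.Probability"
begin

text \<open>
  Indices are 0-based: the observed values are \<open>X 0, \<dots>, X (n - 1)\<close>, the hidden variables are
  \<open>Y 0, \<dots>, Y (m - 1)\<close>, and only the entries \<open>A i j\<close> with \<open>i < n\<close> and \<open>j < m\<close> matter.
\<close>

text \<open>
  Integrability of the hidden variables is the standing assumption that makes all expectations
  below finite, so that the Bochner integral is the usual expectation.
\<close>

definition lcp_instance ::
  "'w measure \<Rightarrow> nat \<Rightarrow> nat \<Rightarrow> (nat \<Rightarrow> nat \<Rightarrow> real) \<Rightarrow> (nat \<Rightarrow> 'w \<Rightarrow> real) \<Rightarrow> bool" where
  "lcp_instance M n m A Y \<longleftrightarrow>
     prob_space M \<and> n \<ge> 1 \<and> m \<ge> 1 \<and>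
     (\<forall>i<n. \<forall>j<m. 0 \<le> A i j) \<and>
     prob_space.indep_vars M (\<lambda>_. borel) Y {..<m} \<and>
     (\<forall>j<m. \<forall>\<omega>\<in>space M. 0 \<le> Y j \<omega>) \<and>
     (\<forall>j<m. integrable M (Y j))"

definition row_sparsity :: "nat \<Rightarrow> nat \<Rightarrow> (nat \<Rightarrow> nat \<Rightarrow> real) \<Rightarrow> nat" where
  "row_sparsity n m A = Max ((\<lambda>i. card {j. j < m \<and> A i j \<noteq> 0}) ` {..<n})"

definition lin_values ::
  "nat \<Rightarrow> (nat \<Rightarrow> nat \<Rightarrow> real) \<Rightarrow> (nat \<Rightarrow> 'w \<Rightarrow> real) \<Rightarrow> nat \<Rightarrow> 'w \<Rightarrow> real" where
  "lin_values m A Y i \<omega> = (\<Sum>j<m. A i j * Y j \<omega>)"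

text \<open>The sum of the \<open>r\<close> largest values (of all values if \<open>n < r\<close>), with multiplicity.\<close>

definition OPT :: "nat \<Rightarrow> nat \<Rightarrow> (nat \<Rightarrow> 'w \<Rightarrow> real) \<Rightarrow> 'w \<Rightarrow> real" where
  "OPT r n X \<omega> = sum_list (take r (rev (sort (map (\<lambda>i. X i \<omega>) [0..<n]))))"

text \<open>
  A (possibly randomized) online algorithm is given by a space \<open>S\<close> of internal random seeds and
  a decision rule: \<open>acc i u x\<close> says whether item \<open>i\<close> is accepted when the seed is \<open>u\<close> and the
  values observed so far are \<open>x\<close>, a function on \<open>{..i}\<close>.  Past decisions are
  determined by \<open>u\<close> and the past values, so they need not be passed to the rule.
\<close>

definition accepted ::
  "nat \<Rightarrow> (nat \<Rightarrow> 'w \<Rightarrow> real) \<Rightarrow> (nat \<Rightarrow> 'u \<Rightarrow> (nat \<Rightarrow> real) \<Rightarrow> bool) \<Rightarrow> 'u \<Rightarrow> 'w \<Rightarrow> nat set" where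
  "accepted n X acc u \<omega> = {i. i < n \<and> acc i u (\<lambda>k\<in>{..i}. X k \<omega>)}"

definition ALG ::
  "nat \<Rightarrow> (nat \<Rightarrow> 'w \<Rightarrow> real) \<Rightarrow> (nat \<Rightarrow> 'u \<Rightarrow> (nat \<Rightarrow> real) \<Rightarrow> bool) \<Rightarrow> 'u \<Rightarrow> 'w \<Rightarrow> real" where
  "ALG n X acc u \<omega> = (\<Sum>i\<in>accepted n X acc u \<omega>. X i \<omega>)"

text \<open>
  The rule may be tailored to the instance, so the cardinality constraint is only imposed on
  outcomes of that instance.
\<close>

definition online_algorithm ::
  "'w measure \<Rightarrow> nat \<Rightarrow> nat \<Rightarrow> (nat \<Rightarrow> 'w \<Rightarrow> real) \<Rightarrow>
   'u measure \<Rightarrow> (nat \<Rightarrow> 'u \<Rightarrow> (nat \<Rightarrow> real) \<Rightarrow> bool) \<Rightarrow> bool" where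
  "online_algorithm M r n X S acc \<longleftrightarrow>
     prob_space S \<and>
     (\<forall>i<n. (\<lambda>(u, x). acc i u x)
        \<in> measurable (S \<Otimes>\<^sub>M (\<Pi>\<^sub>M k\<in>{..i}. (borel :: real measure))) (count_space UNIV)) \<and>
     (\<forall>u\<in>space S. \<forall>\<omega>\<in>space M. card (accepted n X acc u \<omega>) \<le> r)"

text \<open>The product measure makes the seed independent of the hidden variables.\<close>

definition expected_ALG ::
  "'w measure \<Rightarrow> nat \<Rightarrow> (nat \<Rightarrow> 'w \<Rightarrow> real) \<Rightarrow>
   'u measure \<Rightarrow> (nat \<Rightarrow> 'u \<Rightarrow> (nat \<Rightarrow> real) \<Rightarrow> bool) \<Rightarrow> real" where
  "expected_ALG M n X S acc = (\<integral>(u, \<omega>). ALG n X acc u \<omega> \<partial>(S \<Otimes>\<^sub>M M))"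

definition expected_OPT :: "'w measure \<Rightarrow> nat \<Rightarrow> nat \<Rightarrow> (nat \<Rightarrow> 'w \<Rightarrow> real) \<Rightarrow> real" where
  "expected_OPT M r n X = (\<integral>\<omega>. OPT r n X \<omega> \<partial>M)"

end

theory Submission
  imports Defs
begin

text \<open>
  Level \<open>j < s\<close> has a coin \<open>Y j\<close> that is \<open>1\<close> with probability \<open>1 / (4 s 2^j)\<close>, and each item of
  level \<open>l\<close> is worth \<open>2^l\<close> times the number of successful coins at levels \<open>j \<ge> l\<close>.  Every level has
  \<open>r\<close> identical items, and the levels arrive in increasing order.  Two coins rarely succeed
  together.  If only coin \<open>j\<close> succeeds, the prophet collects \<open>r 2^j\<close>, which contributes about
  \<open>r / (4 s)\<close> for each of the \<open>s\<close> levels.  The algorithm, up to level \<open>j\<close>, sees the same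
  values \<open>2^l\<close> whatever \<open>j\<close> is, so its decisions there come from one fixed set of at most \<open>r\<close> items.  An
  item of level \<open>l\<close> in that set earns \<open>2^l\<close> with probability at most \<open>2 / (4 s 2^l)\<close>, so the
  algorithm gets \<open>O(r / s)\<close> in total.
\<close>

section \<open>The hard instance\<close>

definition level_matrix :: "nat \<Rightarrow> nat \<Rightarrow> nat \<Rightarrow> real" where
  "level_matrix r i j = (if i div r \<le> j then 2 ^ (i div r) else 0)"

text \<open>The weight \<open>2 ^ j\<close> cancels, so each level contributes the same
  \<open>2 ^ j * level_prob s j = 1 / (4 s)\<close>. The factor 4 keeps the expected
  \<open>clash\<close>, at most 1/8, within half of the total 1/4.\<close>

definition level_prob :: "nat \<Rightarrow> nat \<Rightarrow> real" where
  "level_prob s j = 1 / (4 * real s * 2 ^ j)"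

text \<open>A product of finitely many two-point laws has finite support, so for a fixed seed every
  reward is integrable.\<close>

definition level_space :: "nat \<Rightarrow> (nat \<Rightarrow> real) pmf" where
  "level_space s = Pi_pmf {..<s} 0 (\<lambda>j. map_pmf of_bool (bernoulli_pmf (level_prob s j)))"

text \<open>Testing for \<open>1\<close> makes the coins nonnegative on the whole sample space, not just almost surely.\<close>

definition coin :: "nat \<Rightarrow> (nat \<Rightarrow> real) \<Rightarrow> real" where
  "coin j \<omega> = of_bool (\<omega> j = 1)"

lemma coin_nonneg [simp]: "0 \<le> coin j \<omega>"
  by (simp add: coin_def)

lemma coin_cases: "coin j \<omega> = 0 \<or> coin j \<omega> = 1"
  by (simp add: coin_def)

lemma level_matrix_nonneg [simp]: "0 \<le> level_matrix r i j"
  by (simp add: level_matrix_def)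

lemma level_matrix_le: "level_matrix r i j \<le> 2 ^ j"
  by (simp add: level_matrix_def)

lemma row_sparsity_level_matrix:
  assumes "r \<ge> 1" "s \<ge> 1"
  shows "row_sparsity (r * s) s (level_matrix r) = s"
  unfolding row_sparsity_def
proof (rule Max_eqI)
  show "finite ((\<lambda>i. card {j. j < s \<and> level_matrix r i j \<noteq> 0}) ` {..<r * s})" by simp
next
  fix y assume "y \<in> (\<lambda>i. card {j. j < s \<and> level_matrix r i j \<noteq> 0}) ` {..<r * s}"
  then obtain i where "y = card {j. j < s \<and> level_matrix r i j \<noteq> 0}" by blast
  moreover have "card {j. j < s \<and> level_matrix r i j \<noteq> 0} \<le> card {..<s}"
    by (rule card_mono) auto
  ultimately show "y \<le> s" by simp
next
  \<comment> \<open>An item of level 0 profits from every coin, so its row is full.\<close>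
  have "{j. j < s \<and> level_matrix r 0 j \<noteq> 0} = {..<s}"
    by (auto simp: level_matrix_def)
  then have "s = card {j. j < s \<and> level_matrix r 0 j \<noteq> 0}" by simp
  then show "s \<in> (\<lambda>i. card {j. j < s \<and> level_matrix r i j \<noteq> 0}) ` {..<r * s}"
    using assms by (intro image_eqI[of _ _ 0]) auto
qed

section \<open>Lower bounds for the sum of the r largest values\<close>

lemma sum_list_take_ge:
  fixes v :: real
  assumes "sorted_wrt (\<ge>) xs" "r \<le> length (filter (\<lambda>x. v \<le> x) xs)"
  shows "real r * v \<le> sum_list (take r xs)"
  using assms
proof (induction xs arbitrary: r)
  case Nil
  then show ?case by simp
next
  case (Cons x xs)
  show ?case
  proof (cases r)
    case 0
    then show ?thesis by simp
  next
    case (Suc r')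
    \<comment> \<open>The head of a descending list is its maximum: if it were below
      \<open>v\<close>, no entry could reach \<open>v\<close>, but at least one must.\<close>
    have "v \<le> x"
    proof (rule ccontr)
      assume "\<not> v \<le> x"
      with Cons.prems(1) have "filter (\<lambda>x. v \<le> x) (x # xs) = []"
        by (auto simp: filter_empty_conv)
      with Cons.prems(2) Suc show False by simp
    qed
    moreover have "real r' * v \<le> sum_list (take r' xs)"
      using Cons.prems Suc \<open>v \<le> x\<close> by (intro Cons.IH) auto
    ultimately show ?thesis using Suc by (simp add: algebra_simps)
  qed
qed

lemma OPT_ge:
  assumes "r \<le> card {i. i < n \<and> v \<le> X i \<omega>}"
  shows "real r * v \<le> OPT r n X \<omega>"
  unfolding OPT_def
proof (rule sum_list_take_ge)
  let ?xs = "map (\<lambda>i. X i \<omega>) [0..<n]"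
  show "sorted_wrt (\<ge>) (rev (sort ?xs))"
    by (simp add: sorted_wrt_rev)
  have "length (filter (\<lambda>x. v \<le> x) (rev (sort ?xs))) = length (filter (\<lambda>x. v \<le> x) ?xs)"
    by (metis filter_sort length_rev length_sort rev_filter)
  also have "\<dots> = card {i. i < n \<and> v \<le> X i \<omega>}"
    unfolding length_filter_conv_card by (intro arg_cong[where f = card]) auto
  finally show "r \<le> length (filter (\<lambda>x. v \<le> x) (rev (sort ?xs)))"
    using assms by simp
qed

section \<open>Distribution of the coins\<close>

context
  fixes r s :: nat
  assumes r: "r \<ge> 1" and s: "s \<ge> 1"
begin

lemma level_prob_nonneg: "0 \<le> level_prob s j"
  by (simp add: level_prob_def)

lemma level_prob_le_1: "level_prob s j \<le> 1"
proof -
  have "1 \<le> real s * 2 ^ j" using s mult_mono[of 1 "real s" 1 "2 ^ j"] by simp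
  then have "1 \<le> 4 * real s * 2 ^ j" by linarith
  then show ?thesis by (simp add: level_prob_def divide_le_eq_1)
qed

text \<open>Probabilities halve from one level to the next, so \<open>level_prob s j = 2 *
  level_prob s j - 2 * level_prob s (Suc j)\<close> and the sum telescopes.\<close>

lemma sum_level_prob_le:
  assumes "i \<le> s"
  shows "(\<Sum>j=i..<s. level_prob s j) \<le> 2 * level_prob s i"
proof -
  have "(\<Sum>j=i..<k. level_prob s j) = 2 * level_prob s i - 2 * level_prob s k" if "i \<le> k" for k
    using that by (induction k rule: dec_induct) (simp_all add: level_prob_def)
  from this[OF assms] show ?thesis using level_prob_nonneg[of s] by simp
qed

lemma finite_level_space: "finite (set_pmf (level_space s))"
  unfolding level_space_def by (subst set_Pi_pmf) (auto intro!: finite_PiE_dflt)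

lemma integrable_level_space [simp]:
  "integrable (measure_pmf (level_space s)) (f :: _ \<Rightarrow> real)"
  by (rule integrable_measure_pmf_finite) (rule finite_level_space)

lemma indep_coins:
  "prob_space.indep_vars (measure_pmf (level_space s)) (\<lambda>_. borel) coin {..<s}"
proof -
  have "prob_space.indep_vars (measure_pmf (level_space s)) (\<lambda>_. count_space UNIV)
          (\<lambda>j \<omega>. \<omega> j) {..<s}"
    unfolding level_space_def by (rule indep_vars_Pi_pmf) simp
  from prob_space.indep_vars_compose2[OF _ this, of "\<lambda>_ x. of_bool (x = 1)" "\<lambda>_. borel"]
  show ?thesis
    unfolding coin_def[abs_def] by (simp add: measure_pmf.prob_space_axioms)
qed

lemma expectation_coin:
  assumes "j < s"
  shows "measure_pmf.expectation (level_space s) (coin j) = level_prob s j"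
proof -
  have "measure_pmf.expectation (level_space s) (coin j) =
      measure_pmf.expectation (map_pmf (\<lambda>\<omega>. \<omega> j) (level_space s)) (\<lambda>x. of_bool (x = 1))"
    by (simp add: coin_def[abs_def])
  also have "map_pmf (\<lambda>\<omega>. \<omega> j) (level_space s) = map_pmf of_bool (bernoulli_pmf (level_prob s j))"
    using assms unfolding level_space_def by (subst Pi_pmf_component) auto
  finally show ?thesis
    using level_prob_nonneg level_prob_le_1 by simp
qed

lemma expectation_coin_mult:
  assumes "j < s" "k < s" "j \<noteq> k"
  shows "measure_pmf.expectation (level_space s) (\<lambda>\<omega>. coin j \<omega> * coin k \<omega>) =
    level_prob s j * level_prob s k"
proof -
  have "prob_space.indep_vars (measure_pmf (level_space s)) (\<lambda>_. borel) coin {j, k}"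
    by (rule prob_space.indep_vars_subset[OF measure_pmf.prob_space_axioms indep_coins]) (use assms in auto)
  then have "measure_pmf.expectation (level_space s) (\<lambda>\<omega>. \<Prod>i\<in>{j, k}. coin i \<omega>) =
      (\<Prod>i\<in>{j, k}. measure_pmf.expectation (level_space s) (coin i))"
    by (intro prob_space.indep_vars_lebesgue_integral) (auto simp: measure_pmf.prob_space_axioms)
  then show ?thesis using assms by (simp add: expectation_coin)
qed

lemma lcp_instance_level:
  "lcp_instance (measure_pmf (level_space s)) (r * s) s (level_matrix r) coin"
  unfolding lcp_instance_def
  using r s indep_coins by (auto simp: measure_pmf.prob_space_axioms)

section \<open>Simultaneous successes\<close>

abbreviation X where "X \<equiv> lin_values s (level_matrix r) coin"

text \<open>Error term for several successes: it vanishes if at most one coin succeeds, and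
  otherwise it is at least the sum of \<open>2 ^ j\<close> over the successful coins. As a
  combination of pair products, its expectation follows from pairwise independence.\<close>

definition clash where
  "clash \<omega> = (\<Sum>j<s. 2 ^ j * (\<Sum>k\<in>{..<s} - {j}. coin j \<omega> * coin k \<omega>))"

text \<open>Each of the s summands is at most 1/(4s), from \<open>2 ^ j * level_prob s j\<close>,
  times 1/(2s), the bound on the total probability of the other coins.\<close>

lemma expectation_clash_le:
  "measure_pmf.expectation (level_space s) clash \<le> 1 / (8 * real s)"
proof -
  have tot: "(\<Sum>k<s. level_prob s k) \<le> 1 / (2 * real s)"
    using sum_level_prob_le[of 0] by (simp add: level_prob_def lessThan_atLeast0)
  have "measure_pmf.expectation (level_space s) clash =
      (\<Sum>j<s. 2 ^ j * (\<Sum>k\<in>{..<s} - {j}. level_prob s j * level_prob s k))"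
    unfolding clash_def by (simp add: expectation_coin_mult)
  also have "\<dots> \<le> (\<Sum>j<s. 1 / (8 * real s ^ 2))"
  proof (rule sum_mono)
    fix j assume "j \<in> {..<s}"
    have "(\<Sum>k\<in>{..<s} - {j}. level_prob s k) \<le> (\<Sum>k<s. level_prob s k)"
      by (intro sum_mono2) (auto simp: level_prob_nonneg)
    with tot have "(\<Sum>k\<in>{..<s} - {j}. level_prob s k) \<le> 1 / (2 * real s)" by linarith
    then have "(2 ^ j * level_prob s j) * (\<Sum>k\<in>{..<s} - {j}. level_prob s k)
        \<le> (2 ^ j * level_prob s j) * (1 / (2 * real s))"
      by (intro mult_left_mono) (auto simp: level_prob_nonneg)
    also have "\<dots> = 1 / (8 * real s ^ 2)"
      using s by (simp add: level_prob_def power2_eq_square)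
    finally show "2 ^ j * (\<Sum>k\<in>{..<s} - {j}. level_prob s j * level_prob s k)
        \<le> 1 / (8 * real s ^ 2)"
      by (simp add: sum_distrib_left mult_ac)
  qed
  also have "\<dots> = 1 / (8 * real s)"
    using s by (simp add: power2_eq_square)
  finally show ?thesis .
qed

section \<open>Reward of the prophet\<close>

lemma X_only:
  assumes "j < s" "coin j \<omega> = 1" "\<And>k. k < s \<Longrightarrow> k \<noteq> j \<Longrightarrow> coin k \<omega> = 0"
  shows "X i \<omega> = level_matrix r i j"
proof -
  have "X i \<omega> = (\<Sum>k<s. if k = j then level_matrix r i j else 0)"
    unfolding lin_values_def by (rule sum.cong) (use assms in auto)
  then show ?thesis using assms(1) by simp
qed

lemma X_nonneg: "0 \<le> X i \<omega>"
  unfolding lin_values_def by (intro sum_nonneg) auto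

text \<open>With exactly one success, at level j, the r items of that level are worth
  \<open>2 ^ j\<close> each. For every other outcome \<open>clash\<close> makes the left side at
  most 0.\<close>

lemma OPT_level_ge:
  "real r * ((\<Sum>j<s. 2 ^ j * coin j \<omega>) - clash \<omega>) \<le> OPT r (r * s) X \<omega>"
proof (cases "\<exists>j<s. coin j \<omega> = 1 \<and> (\<forall>k<s. k \<noteq> j \<longrightarrow> coin k \<omega> = 0)")
  case True
  then obtain j where j: "j < s" "coin j \<omega> = 1" "\<And>k. k < s \<Longrightarrow> k \<noteq> j \<Longrightarrow> coin k \<omega> = 0" by blast
  have "(\<Sum>i<s. 2 ^ i * coin i \<omega>) = (\<Sum>i<s. if i = j then 2 ^ j else 0)"
    by (rule sum.cong) (use j in auto)
  moreover have "0 \<le> clash \<omega>"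
    unfolding clash_def by (intro sum_nonneg mult_nonneg_nonneg) auto
  ultimately have "(\<Sum>j<s. 2 ^ j * coin j \<omega>) - clash \<omega> \<le> 2 ^ j"
    using j(1) by simp
  then have "real r * ((\<Sum>j<s. 2 ^ j * coin j \<omega>) - clash \<omega>) \<le> real r * 2 ^ j"
    by (intro mult_left_mono) auto
  also have "\<dots> \<le> OPT r (r * s) X \<omega>"
  proof (rule OPT_ge)
    have "Suc j * r \<le> s * r" using j(1) by (intro mult_right_mono) auto
    moreover have "i div r = j" if "i \<in> {j * r..<j * r + r}" for i
      using that by (intro div_nat_eqI) (auto simp: mult.commute)
    ultimately have "{j * r..<j * r + r} \<subseteq> {i. i < r * s \<and> 2 ^ j \<le> X i \<omega>}"
      by (auto simp: X_only[OF j] level_matrix_def mult.commute)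
    from card_mono[OF _ this] show "r \<le> card {i. i < r * s \<and> 2 ^ j \<le> X i \<omega>}" by simp
  qed
  finally show ?thesis .
next
  case False
  have "2 ^ j * coin j \<omega> \<le> 2 ^ j * (\<Sum>k\<in>{..<s} - {j}. coin j \<omega> * coin k \<omega>)" if "j < s" for j
  proof (cases "coin j \<omega> = 0")
    case True
    then show ?thesis by simp
  next
    case nz: False
    then have 1: "coin j \<omega> = 1" using coin_cases by blast
    \<comment> \<open>A successful coin is not the only one here, so a partner k makes its
      \<open>clash\<close> summand at least \<open>2 ^ j\<close>.\<close>
    with False that obtain k where k: "k < s" "k \<noteq> j" "coin k \<omega> = 1"
      using coin_cases by blast
    then have "coin k \<omega> \<le> (\<Sum>k\<in>{..<s} - {j}. coin k \<omega>)"
      by (intro member_le_sum) auto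
    with 1 k show ?thesis by simp
  qed
  then have "(\<Sum>j<s. 2 ^ j * coin j \<omega>) \<le> clash \<omega>"
    unfolding clash_def by (intro sum_mono) auto
  then have "real r * ((\<Sum>j<s. 2 ^ j * coin j \<omega>) - clash \<omega>) \<le> real r * 0"
    by (intro mult_left_mono) auto
  also have "real r * 0 \<le> OPT r (r * s) X \<omega>"
  proof (rule OPT_ge)
    have "{i. i < r * s \<and> 0 \<le> X i \<omega>} = {..<r * s}" using X_nonneg by auto
    then show "r \<le> card {i. i < r * s \<and> 0 \<le> X i \<omega>}" using s by simp
  qed
  finally show ?thesis .
qed

lemma expected_OPT_level_ge:
  "real r / 8 \<le> expected_OPT (measure_pmf (level_space s)) r (r * s) X"
proof -
  have "measure_pmf.expectation (level_space s) (\<lambda>\<omega>. real r * ((\<Sum>j<s. 2 ^ j * coin j \<omega>) - clash \<omega>))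
      = real r * ((\<Sum>j<s. 2 ^ j * level_prob s j) - measure_pmf.expectation (level_space s) clash)"
    by (simp add: expectation_coin)
  also have "(\<Sum>j<s. 2 ^ j * level_prob s j) = 1 / 4"
    using s by (simp add: level_prob_def)
  finally have eq: "measure_pmf.expectation (level_space s)
      (\<lambda>\<omega>. real r * ((\<Sum>j<s. 2 ^ j * coin j \<omega>) - clash \<omega>))
      = real r * (1 / 4 - measure_pmf.expectation (level_space s) clash)" .
  \<comment> \<open>Hence 1/4 minus the expected \<open>clash\<close> is still at least 1/8.\<close>
  have "1 / (8 * real s) \<le> 1 / 8" using s by (simp add: field_simps)
  with expectation_clash_le
  have "real r * (1 / 8) \<le> real r * (1 / 4 - measure_pmf.expectation (level_space s) clash)"
    by (intro mult_left_mono) auto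
  also have "\<dots> \<le> expected_OPT (measure_pmf (level_space s)) r (r * s) X"
    unfolding expected_OPT_def eq[symmetric]
    by (intro integral_mono OPT_level_ge) auto
  finally show ?thesis by simp
qed

section \<open>Reward of an online algorithm\<close>

lemma ALG_level_le:
  assumes card: "\<And>\<omega>. card (accepted (r * s) X acc u \<omega>) \<le> r"
  defines "G \<equiv> {i. i < r * s \<and> acc i u (\<lambda>k\<in>{..i}. 2 ^ (k div r))}"
  shows "ALG (r * s) X acc u \<omega> \<le> (\<Sum>j<s. coin j \<omega> * (\<Sum>i\<in>G. level_matrix r i j)) + real r * clash \<omega>"
proof -
  let ?Q = "accepted (r * s) X acc u \<omega>"
  have fin: "finite ?Q" "finite G" by (auto simp: accepted_def G_def)
  \<comment> \<open>The bound is proved coin by coin. \<open>G\<close> is what the rule accepts when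
    every item of level l shows \<open>2 ^ l\<close>; it depends on the seed but not on the
    outcome.\<close>
  have "coin j \<omega> * (\<Sum>i\<in>?Q. level_matrix r i j) \<le> coin j \<omega> * (\<Sum>i\<in>G. level_matrix r i j)
      + real r * (2 ^ j * (\<Sum>k\<in>{..<s} - {j}. coin j \<omega> * coin k \<omega>))" (is "?L \<le> ?R1 + ?R2")
    if j: "j < s" for j
  proof (cases "coin j \<omega> = 0")
    case True
    then show ?thesis by simp
  next
    case False
    then have 1: "coin j \<omega> = 1" using coin_cases by blast
    show ?thesis
    proof (cases "\<exists>k<s. k \<noteq> j \<and> coin k \<omega> = 1")
      case True
      then obtain k where k: "k < s" "k \<noteq> j" "coin k \<omega> = 1" by blast
      then have "coin k \<omega> \<le> (\<Sum>k\<in>{..<s} - {j}. coin k \<omega>)"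
        by (intro member_le_sum) auto
      with k have sum1: "1 \<le> (\<Sum>k\<in>{..<s} - {j}. coin k \<omega>)" by simp
      \<comment> \<open>At most r accepted items gain at most \<open>2 ^ j\<close> each from coin j,
        and all of this is charged to \<open>clash\<close>.\<close>
      have "(\<Sum>i\<in>?Q. level_matrix r i j) \<le> real (card ?Q) * 2 ^ j"
        using level_matrix_le by (intro sum_bounded_above) auto
      also have "\<dots> \<le> real r * 2 ^ j" using card by (intro mult_right_mono) auto
      also have "\<dots> \<le> real r * (2 ^ j * (\<Sum>k\<in>{..<s} - {j}. coin k \<omega>))"
        using sum1 by (simp add: mult_left_mono)
      also have "\<dots> = ?R2" using 1 by simp
      finally have "?L \<le> ?R2" using 1 by simp
      moreover have "0 \<le> ?R1" by (intro mult_nonneg_nonneg sum_nonneg) auto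
      ultimately show ?thesis by linarith
    next
      case False
      then have only: "\<And>k. k < s \<Longrightarrow> k \<noteq> j \<Longrightarrow> coin k \<omega> = 0" using coin_cases by blast
      \<comment> \<open>Up to level j the observed prefix is the one defining \<open>G\<close>, and
        the rule sees nothing else.\<close>
      have "i \<in> ?Q \<longleftrightarrow> i \<in> G" if "i div r \<le> j" for i
      proof -
        have "k div r \<le> j" if "k \<le> i" for k
          using that \<open>i div r \<le> j\<close> div_le_mono le_trans by blast
        then have "(\<lambda>k\<in>{..i}. X k \<omega>) = (\<lambda>k\<in>{..i}. 2 ^ (k div r))"
          by (intro restrict_ext) (simp add: X_only[OF j 1 only] level_matrix_def)
        then show ?thesis by (simp add: accepted_def G_def)
      qed
      \<comment> \<open>\<open>?Q\<close> and \<open>G\<close> may differ only above level j, where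
        coin j has coefficient 0.\<close>
      then have "(\<Sum>i\<in>?Q. level_matrix r i j) = (\<Sum>i\<in>G. level_matrix r i j)"
        using fin by (intro sum.mono_neutral_cong) (auto simp: level_matrix_def)
      moreover have "0 \<le> ?R2" by (intro mult_nonneg_nonneg sum_nonneg) auto
      ultimately show ?thesis by simp
    qed
  qed
  then have "(\<Sum>j<s. coin j \<omega> * (\<Sum>i\<in>?Q. level_matrix r i j)) \<le>
      (\<Sum>j<s. coin j \<omega> * (\<Sum>i\<in>G. level_matrix r i j)
        + real r * (2 ^ j * (\<Sum>k\<in>{..<s} - {j}. coin j \<omega> * coin k \<omega>)))"
    by (intro sum_mono) auto
  also have "\<dots> = (\<Sum>j<s. coin j \<omega> * (\<Sum>i\<in>G. level_matrix r i j)) + real r * clash \<omega>"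
    by (simp add: sum.distrib clash_def sum_distrib_left)
  also have "(\<Sum>j<s. coin j \<omega> * (\<Sum>i\<in>?Q. level_matrix r i j)) = ALG (r * s) X acc u \<omega>"
    unfolding ALG_def lin_values_def
    by (subst sum.swap) (simp add: sum_distrib_left mult.commute)
  finally show ?thesis .
qed

lemma expectation_ALG_level_le:
  assumes card: "\<And>\<omega>. card (accepted (r * s) X acc u \<omega>) \<le> r"
  shows "measure_pmf.expectation (level_space s) (ALG (r * s) X acc u) \<le> 3 / 4 * (real r / real s)"
proof -
  define G where "G = {i. i < r * s \<and> acc i u (\<lambda>k\<in>{..i}. 2 ^ (k div r))}"
  \<comment> \<open>In the outcome \<open>top\<close> only the last coin succeeds, so all items show
    their full level value. Thus \<open>G\<close> is a set really accepted, and it inherits the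
    bound r on its size.\<close>
  define top :: "nat \<Rightarrow> real" where "top = (\<lambda>j. of_bool (j = s - 1))"
  have "X i top = 2 ^ (i div r)" if "i < r * s" for i
  proof -
    have "i div r < s" using that r by (simp add: div_less_iff_less_mult mult.commute)
    then have "i div r \<le> s - 1" by simp
    then show ?thesis
      using s by (subst X_only[of "s - 1"]) (auto simp: coin_def top_def level_matrix_def)
  qed
  then have "(\<lambda>k\<in>{..i}. X k top) = (\<lambda>k\<in>{..i}. 2 ^ (k div r))" if "i < r * s" for i
    using that by (intro restrict_ext) auto
  then have "G = accepted (r * s) X acc u top"
    by (auto simp: G_def accepted_def)
  then have cardG: "card G \<le> r" using card by simp
  \<comment> \<open>An item of level l gains \<open>2 ^ l\<close> from each coin at level l or
    above, and the tail sum is at most twice its first term; the result is the same for all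
    levels.\<close>
  have inner: "(\<Sum>j<s. level_prob s j * level_matrix r i j) \<le> 1 / (2 * real s)" if "i \<in> G" for i
  proof -
    have "i div r < s" using that r by (simp add: G_def div_less_iff_less_mult mult.commute)
    have "(\<Sum>j<s. level_prob s j * level_matrix r i j) =
        (\<Sum>j=i div r..<s. 2 ^ (i div r) * level_prob s j)"
      by (rule sum.mono_neutral_cong_right) (auto simp: level_matrix_def)
    also have "\<dots> \<le> 2 ^ (i div r) * (2 * level_prob s (i div r))"
      using sum_level_prob_le[of "i div r"] \<open>i div r < s\<close>
      by (simp add: sum_distrib_left[symmetric])
    also have "\<dots> = 1 / (2 * real s)" by (simp add: level_prob_def)
    finally show ?thesis .
  qed
  let ?g = "\<lambda>\<omega>. (\<Sum>j<s. coin j \<omega> * (\<Sum>i\<in>G. level_matrix r i j)) + real r * clash \<omega>"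
  have "measure_pmf.expectation (level_space s) (ALG (r * s) X acc u)
      \<le> measure_pmf.expectation (level_space s) ?g"
    using ALG_level_le[of acc u] card unfolding G_def by (intro integral_mono) auto
  also have "\<dots> = (\<Sum>j<s. level_prob s j * (\<Sum>i\<in>G. level_matrix r i j))
      + real r * measure_pmf.expectation (level_space s) clash"
    by (simp add: expectation_coin)
  also have "(\<Sum>j<s. level_prob s j * (\<Sum>i\<in>G. level_matrix r i j)) =
      (\<Sum>i\<in>G. \<Sum>j<s. level_prob s j * level_matrix r i j)"
    by (simp add: sum_distrib_left) (rule sum.swap)
  also have "\<dots> \<le> real (card G) * (1 / (2 * real s))"
    using inner by (rule sum_bounded_above)
  also have "\<dots> \<le> real r * (1 / (2 * real s))"
    using cardG by (intro mult_right_mono) auto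
  also have "real r * measure_pmf.expectation (level_space s) clash \<le> real r * (1 / (8 * real s))"
    using expectation_clash_le by (intro mult_left_mono) auto
  finally have "measure_pmf.expectation (level_space s) (ALG (r * s) X acc u)
    \<le> real r * (1 / (2 * real s)) + real r * (1 / (8 * real s))" by simp
  \<comment> \<open>1/2 + 1/8 = 5/8, rounded up to 3/4.\<close>
  also have "\<dots> \<le> 3 / 4 * (real r / real s)" using s by (simp add: field_simps)
  finally show ?thesis .
qed

text \<open>The bound holds for each fixed seed, and Fubini averages it over the seeds.\<close>

lemma expected_ALG_level_le:
  assumes "online_algorithm (measure_pmf (level_space s)) r (r * s) X S acc"
  shows "expected_ALG (measure_pmf (level_space s)) (r * s) X S acc \<le> 3 / 4 * (real r / real s)"
proof -
  let ?M = "measure_pmf (level_space s)"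
  interpret S: prob_space S using assms by (simp add: online_algorithm_def)
  interpret P: pair_sigma_finite S ?M ..
  have inner: "measure_pmf.expectation (level_space s) (ALG (r * s) X acc u)
      \<le> 3 / 4 * (real r / real s)" if "u \<in> space S" for u
    using assms that by (intro expectation_ALG_level_le) (auto simp: online_algorithm_def)
  show ?thesis
  proof (cases "integrable (S \<Otimes>\<^sub>M ?M) (\<lambda>(u, \<omega>). ALG (r * s) X acc u \<omega>)")
    case True
    from P.integral_fst[OF True]
    have "expected_ALG ?M (r * s) X S acc = (\<integral>u. \<integral>\<omega>. ALG (r * s) X acc u \<omega> \<partial>?M \<partial>S)"
      by (simp add: expected_ALG_def)
    also have "\<dots> \<le> (\<integral>u. 3 / 4 * (real r / real s) \<partial>S)"
      using inner by (intro integral_mono') auto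
    finally show ?thesis by (simp add: S.prob_space)
  next
    \<comment> \<open>The Bochner integral of a non-integrable function is 0, below the nonnegative
      bound.\<close>
    case False
    then show ?thesis by (simp add: expected_ALG_def not_integrable_integral_eq)
  qed
qed

end

theorem theorem5p3:
  "\<exists>c::real. c > 0 \<and>
     (\<forall>r\<ge>1::nat. \<forall>s\<ge>1::nat.
        \<exists>(M :: (nat \<Rightarrow> real) measure) (n::nat) (m::nat) (A :: nat \<Rightarrow> nat \<Rightarrow> real)
         (Y :: nat \<Rightarrow> (nat \<Rightarrow> real) \<Rightarrow> real).
          lcp_instance M n m A Y \<and>
          row_sparsity n m A = s \<and>
          expected_OPT M r n (lin_values m A Y) > 0 \<and>
          (\<forall>(S :: real measure) (acc :: nat \<Rightarrow> real \<Rightarrow> (nat \<Rightarrow> real) \<Rightarrow> bool).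
             online_algorithm M r n (lin_values m A Y) S acc \<longrightarrow>
             expected_ALG M n (lin_values m A Y) S acc
               \<le> 1 / (c * real s) * expected_OPT M r n (lin_values m A Y)))"
\<comment> \<open>The constant comes from 3/4 * r/s = (6/s) * (r/8), with r/8 the lower bound for
  the prophet.\<close>
proof (intro exI[of _ "1 / 6 :: real"] conjI allI impI)
  fix r s :: nat assume rs: "r \<ge> 1" "s \<ge> 1"
  let ?M = "measure_pmf (level_space s)" and ?X = "lin_values s (level_matrix r) coin"
  note opt = expected_OPT_level_ge[OF rs]
  have "expected_ALG ?M (r * s) ?X S acc \<le> 1 / (1 / 6 * real s) * expected_OPT ?M r (r * s) ?X"
    if "online_algorithm ?M r (r * s) ?X S acc"
    for S :: "real measure" and acc :: "nat \<Rightarrow> real \<Rightarrow> (nat \<Rightarrow> real) \<Rightarrow> bool"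
  proof -
    have "expected_ALG ?M (r * s) ?X S acc \<le> 3 / 4 * (real r / real s)"
      by (rule expected_ALG_level_le[OF rs that])
    also have "\<dots> = 6 / real s * (real r / 8)" by simp
    also have "\<dots> \<le> 6 / real s * expected_OPT ?M r (r * s) ?X"
      using opt by (intro mult_left_mono) auto
    finally show ?thesis by simp
  qed
  moreover have "0 < expected_OPT ?M r (r * s) ?X"
    using opt rs by (intro less_le_trans[OF _ opt]) auto
  ultimately show "\<exists>(M :: (nat \<Rightarrow> real) measure) n m A Y.
          lcp_instance M n m A Y \<and>
          row_sparsity n m A = s \<and>
          expected_OPT M r n (lin_values m A Y) > 0 \<and>
          (\<forall>(S :: real measure) (acc :: nat \<Rightarrow> real \<Rightarrow> (nat \<Rightarrow> real) \<Rightarrow> bool).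
             online_algorithm M r n (lin_values m A Y) S acc \<longrightarrow>
             expected_ALG M n (lin_values m A Y) S acc
               \<le> 1 / (1 / 6 * real s) * expected_OPT M r n (lin_values m A Y))"
    using lcp_instance_level[OF rs] row_sparsity_level_matrix[OF rs] by blast
qed simp

end
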